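(* Let $G=SL_3(K)$ and let $B$ be the Borel subgroup of upper triangular matrices in $G$. Let $p(Y)=1+\sum_{i\ge 1}p_i(t)Y^i$ be a polynomial in $Y$ with coefficients $p_i(t)\in F$ and constant term $1$. Suppose that the associated map $$\psi_p:T^*G/B=G\times^B\underline{b}_u\rightarrow\mathcal{G}/\mathcal{B},\qquad \psi_p(g,Y)=g\,p(Y)\ (\mathrm{mod}\ \mathcal{B}),$$ is injective. Then there exist $g\in G$, $w\in\widehat{W}$ and $Y\in\underline{b}_u$ such that $\psi_p(g,Y)\in\mathcal{B}w\mathcal{B}\ (\mathrm{mod}\ \mathcal{B})$ and $l(w)>6$.
   Context: $K=\mathbb{C}$, $A=K[[t]]$, $F=K((t))$; $\underline{b}_u$ is the Lie algebra of the unipotent radical of $B$ (strictly upper triangular $3\times 3$ matrices over $K$). $\mathcal{G}=SL_3(F)$, and $\mathcal{B}\subset SL_3(A)$ is the preimage of $B$ under $SL_3(A)\to SL_3(K)$, $t\mapsto 0$. The cotangent bundle is $T^*G/B=G\times^B\underline{b}_u=(G\times\underline{b}_u)/\sim$, where $(g,Y)\sim(gb,b^{-1}Yb)$ for $b\in B$; the map $\psi_p$ is well defined. $\widehat{W}=N(K[t,t^{-1}])/T$ is the affine Weyl group, where $T$ is the diagonal torus of $G$ and $N$ its normalizer in $G$; $l$ is its Coxeter length with respect to the generators $s_0,s_1,s_2$, where $s_1,s_2$ are represented by the matrices $$\begin{pmatrix}0&1&0\\-1&0&0\\0&0&1\end{pmatrix},\quad \begin{pmatrix}1&0&0\\0&0&1\\0&-1&0\end{pmatrix}$$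 and $s_0$ by $\begin{pmatrix}0&0&t^{-1}\\0&1&0\\-t&0&0\end{pmatrix}$. One has the Bruhat decomposition $\mathcal{G}=\dot\bigcup_{w\in\widehat{W}}\mathcal{B}w\mathcal{B}$. *)

theory Defs
  imports
    "HOL-Analysis.Analysis"
    "HOL-Computational_Algebra.Formal_Laurent_Series"
    "HOL-Computational_Algebra.Polynomial"
    "HOL-Algebra.Group_Action"
    "HOL-Algebra.Left_Coset"
begin

unbundle no Formal_Power_Series.fps_syntax

text \<open>
  All matrices have entries in the field \<open>F\<close> of formal Laurent series in \<open>t\<close> over the complex
  numbers. The rings \<open>K\<close>, \<open>A = K[[t]]\<close> and \<open>K[t, t\<^sup>-\<^sup>1]\<close> are realised as subrings of \<open>F\<close>, so that
  the groups of points over them are literally subgroups of \<open>SL\<^sub>3(F)\<close>.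
\<close>

type_synonym F = "complex fls"
type_synonym matF = "F^3^3"

definition K_ring :: "F set"
  where "K_ring = range fls_const"

definition A_ring :: "F set"
  where "A_ring = range fps_to_fls"

definition Laurent_poly_ring :: "F set"
  where "Laurent_poly_ring = {f. finite {n. fls_nth f n \<noteq> 0}}"

definition SL3 :: "F set \<Rightarrow> matF monoid"
  where "SL3 R = \<lparr>carrier = {M. det M = 1 \<and> (\<forall>i j. M$i$j \<in> R)}, mult = (**), one = mat 1\<rparr>"

abbreviation G_grp :: "matF monoid"
  where "G_grp \<equiv> SL3 K_ring"

abbreviation loop_grp :: "matF monoid"
  where "loop_grp \<equiv> SL3 UNIV"

text \<open>The index type \<open>3\<close> has \<open>3 = 0\<close>, so its order is not the order of the rows \<open>1, 2, 3\<close>;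
  hence the triangular shapes are spelled out entrywise.\<close>

definition Borel :: "matF set"
  where "Borel = {M \<in> carrier G_grp. M$2$1 = 0 \<and> M$3$1 = 0 \<and> M$3$2 = 0}"

definition b_u :: "matF set"
  where "b_u = {Y. (\<forall>i j. Y$i$j \<in> K_ring) \<and>
                   Y$1$1 = 0 \<and> Y$2$2 = 0 \<and> Y$3$3 = 0 \<and> Y$2$1 = 0 \<and> Y$3$1 = 0 \<and> Y$3$2 = 0}"

text \<open>The map \<open>t \<mapsto> 0\<close>, meaningful on matrices over \<open>A\<close>.\<close>

definition reduce0 :: "matF \<Rightarrow> matF"
  where "reduce0 M = (\<chi> i j. fls_const (fls_nth (M$i$j) 0))"

definition Iwahori :: "matF set"
  where "Iwahori = {M \<in> carrier (SL3 A_ring). reduce0 M \<in> Borel}"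

definition cotangent_rel :: "((matF \<times> matF) \<times> (matF \<times> matF)) set"
  where "cotangent_rel =
    {((g, Y), (g', Y')). g \<in> carrier G_grp \<and> Y \<in> b_u \<and>
       (\<exists>b\<in>Borel. g' = g ** b \<and> Y' = matrix_inv b ** Y ** b)}"

definition cotangent_bundle :: "(matF \<times> matF) set set"
  where "cotangent_bundle = (carrier G_grp \<times> b_u) // cotangent_rel"

definition cotangent_class :: "matF \<Rightarrow> matF \<Rightarrow> (matF \<times> matF) set"
  where "cotangent_class g Y = cotangent_rel `` {(g, Y)}"

definition poly_mat :: "F poly \<Rightarrow> matF \<Rightarrow> matF"
  where "poly_mat p Y = (\<Sum>i\<le>degree p. mat (coeff p i) ** (((**) Y) ^^ i) (mat 1))"

text \<open>A point of \<open>\<G>/\<B>\<close> is a left coset of \<open>\<B>\<close>. The map \<open>\<psi>\<^sub>p\<close> sends a class to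
  the union of the cosets assigned to its representatives, which is a single coset because these
  cosets all coincide (lemma \<open>psi_class\<close> below).\<close>

definition psi :: "F poly \<Rightarrow> (matF \<times> matF) set \<Rightarrow> matF set"
  where "psi p X = (\<Union>(g, Y)\<in>X. (g ** poly_mat p Y) <#\<^bsub>loop_grp\<^esub> Iwahori)"

definition torus :: "F set \<Rightarrow> matF set"
  where "torus R = {M \<in> carrier (SL3 R). \<forall>i j. i \<noteq> j \<longrightarrow> M$i$j = 0}"

text \<open>The points of the normalizer \<open>N\<close> of the diagonal torus over the ring \<open>R\<close>.\<close>

definition torus_normalizer :: "F set \<Rightarrow> matF monoid"
  where "torus_normalizer R = (SL3 R)\<lparr>carrier := normalizer (SL3 R) (torus R)\<rparr>"

text \<open>The elements of the affine Weyl group are cosets of \<open>T(K)\<close>, not of \<open>T(K[t, t\<^sup>-\<^sup>1])\<close>.\<close>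

definition affine_Weyl :: "matF set monoid"
  where "affine_Weyl = torus_normalizer Laurent_poly_ring Mod torus K_ring"

definition s1_mat :: matF
  where "s1_mat = vector [vector [0, 1, 0], vector [-1, 0, 0], vector [0, 0, 1]]"

definition s2_mat :: matF
  where "s2_mat = vector [vector [1, 0, 0], vector [0, 0, 1], vector [0, -1, 0]]"

definition s0_mat :: matF
  where "s0_mat = vector [vector [0, 0, fls_X_inv], vector [0, 1, 0], vector [- fls_X, 0, 0]]"

definition simple_reflections :: "matF set set"
  where "simple_reflections =
    (\<lambda>s. torus K_ring #>\<^bsub>torus_normalizer Laurent_poly_ring\<^esub> s) ` {s0_mat, s1_mat, s2_mat}"

definition Coxeter_length :: "matF set \<Rightarrow> nat"
  where "Coxeter_length w = (LEAST n. \<exists>ss. length ss = n \<and> set ss \<subseteq> simple_reflections \<and>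
           w = foldr (mult affine_Weyl) ss (one affine_Weyl))"

text \<open>\<open>\<B>w\<B>\<close>, where \<open>w\<close> is a coset of the torus; as \<open>T(K) \<subseteq> \<B>\<close>, this agrees with
  the double coset of any representative of \<open>w\<close>.\<close>

definition Bruhat_cell :: "matF set \<Rightarrow> matF set"
  where "Bruhat_cell w = Iwahori <#>\<^bsub>loop_grp\<^esub> w <#>\<^bsub>loop_grp\<^esub> Iwahori"

definition mod_Iwahori :: "matF set \<Rightarrow> matF set set"
  where "mod_Iwahori S = (\<lambda>x. x <#\<^bsub>loop_grp\<^esub> Iwahori) ` S"

text \<open>Well-definedness of \<open>\<psi>\<^sub>p\<close>.\<close>

lemma K_ring_closed:
  "0 \<in> K_ring" "1 \<in> K_ring"
  "x \<in> K_ring \<Longrightarrow> y \<in> K_ring \<Longrightarrow> x * y \<in> K_ring"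
  "x \<in> K_ring \<Longrightarrow> y \<in> K_ring \<Longrightarrow> x - y \<in> K_ring"
  "x \<in> K_ring \<Longrightarrow> y \<in> K_ring \<Longrightarrow> x + y \<in> K_ring"
  "x \<in> K_ring \<Longrightarrow> - x \<in> K_ring"
  unfolding K_ring_def image_def
  by (auto intro: exI[of _ 0] exI[of _ 1] fls_const_mult_const fls_plus_const fls_minus_const
      simp flip: fls_const_uminus)

lemma A_ring_closed:
  "x \<in> A_ring \<Longrightarrow> y \<in> A_ring \<Longrightarrow> x * y \<in> A_ring"
  "x \<in> A_ring \<Longrightarrow> y \<in> A_ring \<Longrightarrow> x + y \<in> A_ring"
  unfolding A_ring_def image_def
  by (auto intro: fls_times_fps_to_fls[symmetric] fps_to_fls_plus[symmetric])

lemma K_ring_subset_A_ring: "K_ring \<subseteq> A_ring"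
proof
  fix x assume "x \<in> K_ring"
  then obtain a where "x = fls_const a" by (auto simp: K_ring_def)
  then have "x = fps_to_fls (fps_const a)" by simp
  then show "x \<in> A_ring" unfolding A_ring_def by (rule range_eqI)
qed

lemma A_ring_nth0_mult:
  "x \<in> A_ring \<Longrightarrow> y \<in> A_ring \<Longrightarrow> fls_nth (x * y) 0 = fls_nth x 0 * fls_nth y 0"
  unfolding A_ring_def by (auto simp flip: fls_times_fps_to_fls)

lemma mult_3:
  fixes M N :: matF
  shows "(M ** N)$i$j = M$i$1 * N$1$j + M$i$2 * N$2$j + M$i$3 * N$3$j"
  by (simp add: matrix_matrix_mult_def sum_3)

lemma Borel_inverse:
  assumes "b \<in> Borel"
  obtains c where "c \<in> Borel" "c ** b = mat 1" "b ** c = mat 1"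
proof -
  define c :: matF where "c = vector [vector [b$2$2 * b$3$3, - (b$1$2 * b$3$3), b$1$2 * b$2$3 - b$1$3 * b$2$2],
      vector [0, b$1$1 * b$3$3, - (b$1$1 * b$2$3)], vector [0, 0, b$1$1 * b$2$2]]"
  have b: "b$2$1 = 0" "b$3$1 = 0" "b$3$2 = 0" "\<And>i j. b$i$j \<in> K_ring" "det b = 1"
    using assms by (auto simp: Borel_def SL3_def)
  have d: "b$1$1 * b$2$2 * b$3$3 = 1"
    using b by (simp add: det_3)
  have d2: "b$1$1 * (b$2$2 * b$3$3) = 1" "b$2$2 * (b$1$1 * b$3$3) = 1" "b$3$3 * (b$1$1 * b$2$2) = 1"
    using d by (simp_all add: algebra_simps)
  have cb: "c ** b = mat 1"
    unfolding vec_eq_iff mult_3 forall_3 c_def mat_def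
    using b d2 by (simp add: algebra_simps)
  have "det c * det b = 1"
    using cb by (metis det_I det_mul)
  then have "det c = 1" using b by simp
  moreover have "\<forall>i j. c$i$j \<in> K_ring"
    unfolding forall_3 c_def using b(4) by (simp add: K_ring_closed)
  ultimately have "c \<in> Borel"
    by (simp add: Borel_def SL3_def c_def)
  moreover have "b ** c = mat 1"
    using cb matrix_left_right_inverse by blast
  ultimately show ?thesis using that cb by blast
qed

lemma Iwahori_mult:
  assumes "x \<in> Iwahori" "y \<in> Iwahori"
  shows "x ** y \<in> Iwahori"
proof -
  have x: "det x = 1" "\<And>i j. x$i$j \<in> A_ring" "reduce0 x \<in> Borel"
    and y: "det y = 1" "\<And>i j. y$i$j \<in> A_ring" "reduce0 y \<in> Borel"
    using assms by (auto simp: Iwahori_def SL3_def)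
  have r: "reduce0 (x ** y) = reduce0 x ** reduce0 y"
    unfolding vec_eq_iff mult_3
    by (auto simp: reduce0_def mult_3 A_ring_nth0_mult x y fls_plus_const)
  have "reduce0 x ** reduce0 y \<in> Borel"
    using x(3) y(3) by (auto simp: Borel_def SL3_def det_mul mult_3 intro!: K_ring_closed)
  then show ?thesis
    using x y by (auto simp: Iwahori_def SL3_def r det_mul mult_3 intro!: A_ring_closed)
qed

lemma Borel_subset_Iwahori: "Borel \<subseteq> Iwahori"
proof
  fix b assume b: "b \<in> Borel"
  then have K: "\<And>i j. b$i$j \<in> K_ring" by (auto simp: Borel_def SL3_def)
  have "fls_const (fls_nth (b$i$j) 0) = b$i$j" for i j
    using K[of i j] by (auto simp: K_ring_def)
  then have "reduce0 b = b" by (simp add: reduce0_def vec_eq_iff)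
  then show "b \<in> Iwahori"
    using b K K_ring_subset_A_ring by (auto simp: Iwahori_def Borel_def SL3_def)
qed

lemma loop_coset: "x <#\<^bsub>loop_grp\<^esub> S = (**) x ` S"
  by (auto simp: l_coset_def SL3_def)

lemma coset_absorb:
  assumes "b \<in> Borel"
  shows "(x ** b) <#\<^bsub>loop_grp\<^esub> Iwahori = x <#\<^bsub>loop_grp\<^esub> Iwahori"
proof -
  obtain c where c: "c \<in> Borel" "c ** b = mat 1" "b ** c = mat 1"
    using Borel_inverse[OF assms] by blast
  have "x ** b ** y \<in> (**) x ` Iwahori" if "y \<in> Iwahori" for y
    using that assms Borel_subset_Iwahori Iwahori_mult
    by (metis image_eqI matrix_mul_assoc subsetD)
  moreover have "x ** y \<in> (**) (x ** b) ` Iwahori" if "y \<in> Iwahori" for y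
  proof
    show "x ** y = (x ** b) ** (c ** y)"
      by (metis c(3) matrix_mul_assoc matrix_mul_rid)
    show "c ** y \<in> Iwahori"
      using that c(1) Borel_subset_Iwahori Iwahori_mult by blast
  qed
  ultimately show ?thesis unfolding loop_coset by auto
qed

lemma matrix_inv_eq:
  fixes b c :: matF
  assumes "c ** b = mat 1" "b ** c = mat 1"
  shows "matrix_inv b = c"
proof -
  have "b ** matrix_inv b = mat 1 \<and> matrix_inv b ** b = mat 1"
    unfolding matrix_inv_def by (rule someI[of _ c]) (use assms in simp)
  then show ?thesis
    using assms by (metis matrix_mul_assoc matrix_mul_lid matrix_mul_rid)
qed

lemma poly_mat_conj:
  fixes b c :: matF
  assumes "c ** b = mat 1" "b ** c = mat 1"
  shows "poly_mat p (c ** Y ** b) = c ** poly_mat p Y ** b"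
proof -
  have pow: "(((**) (c ** Y ** b)) ^^ i) (mat 1) = c ** (((**) Y) ^^ i) (mat 1) ** b" for i
  proof (induction i)
    case (Suc i)
    have "c ** Y ** b ** (c ** Z ** b) = c ** (Y ** Z) ** b" for Z
      by (metis assms(2) matrix_mul_assoc matrix_mul_lid)
    then show ?case using Suc by simp
  qed (use assms in simp)
  have com: "mat k ** (c ** Z ** b) = c ** (mat k ** Z) ** b" for k :: F and Z
    unfolding vec_eq_iff mult_3 mat_def by (simp add: forall_3 mult_3 algebra_simps)
  have dist: "(\<Sum>i\<in>I. c ** f i ** b) = c ** (\<Sum>i\<in>I. f i) ** b"
    if "finite I" for I :: "nat set" and f :: "nat \<Rightarrow> matF"
    using that
  proof induction
    case empty
    show ?case unfolding vec_eq_iff mult_3 by simp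
  next
    case (insert i I)
    then show ?case by (simp add: vec_eq_iff mult_3 algebra_simps)
  qed
  show ?thesis
    unfolding poly_mat_def pow com by (rule dist) simp
qed

lemma psi_class:
  assumes "g \<in> carrier G_grp" "Y \<in> b_u"
  shows "psi p (cotangent_class g Y) = (g ** poly_mat p Y) <#\<^bsub>loop_grp\<^esub> Iwahori"
proof -
  have eq: "(g' ** poly_mat p Y') <#\<^bsub>loop_grp\<^esub> Iwahori = (g ** poly_mat p Y) <#\<^bsub>loop_grp\<^esub> Iwahori"
    if "(g', Y') \<in> cotangent_class g Y" for g' Y'
  proof -
    obtain b where b: "b \<in> Borel" "g' = g ** b" "Y' = matrix_inv b ** Y ** b"
      using \<open>(g', Y') \<in> cotangent_class g Y\<close> by (auto simp: cotangent_class_def cotangent_rel_def)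
    obtain c where c: "c ** b = mat 1" "b ** c = mat 1"
      using Borel_inverse[OF b(1)] by blast
    have "g' ** poly_mat p Y' = (g ** poly_mat p Y) ** b"
      unfolding b matrix_inv_eq[OF c] poly_mat_conj[OF c]
      by (metis c(2) matrix_mul_assoc matrix_mul_lid)
    then show ?thesis using coset_absorb[OF b(1)] by simp
  qed
  have "mat 1 \<in> Borel"
    by (auto simp: Borel_def SL3_def mat_def K_ring_closed intro: det_I[unfolded mat_def])
  then have "(g, Y) \<in> cotangent_class g Y"
    unfolding cotangent_class_def cotangent_rel_def using assms
    by (auto intro!: bexI[of _ "mat 1"] simp: matrix_inv_eq[of "mat 1" "mat 1"])
  then show ?thesis
    unfolding psi_def using eq by blast
qed

end

theory Submission
  imports Defs
begin

text \<open>
  Write \<open>f = p\<^sub>1\<close> and \<open>h = p\<^sub>2\<close>. If \<open>f\<close> had no pole, then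
  \<open>p(Y)\<close> would lie in the Iwahori subgroup for every multiple \<open>Y\<close> of the elementary matrix
  \<open>E\<^sub>1\<^sub>3\<close>, and \<open>\<psi>\<^sub>p\<close> would not be injective
  (\<open>injective_imp_pole\<close>). So \<open>f\<close> has a pole, of order \<open>n \<ge> 1\<close> say, and a
  pole of \<open>f\<close> forces some point of the image into a long cell.

  The point comes from the regular nilpotent \<open>Y = E\<^sub>1\<^sub>2 + E\<^sub>2\<^sub>3\<close> and from a
  signed permutation matrix \<open>g\<close> for the longest element of the finite Weyl group, which turns
  \<open>p(Y)\<close> into a matrix \<open>x\<close> whose lower right corner minors are \<open>h\<close> and \<open>D
  = f\<^sup>2 - h\<close>. Their sum \<open>f\<^sup>2\<close> has a pole of order \<open>2n\<close>, so
  \<open>h\<close> or \<open>D\<close> has a pole of order at least \<open>2n\<close>. Gaussian elimination over the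
  Iwahori subgroup reduces \<open>x\<close> to a monomial matrix, whose shape depends only on whether the poles of
  \<open>h\<close> and of \<open>D\<close> exceed \<open>n\<close>; in each of the three cases the length is at least
  \<open>7\<close> (\<open>long_Bruhat_cell\<close>).

  Lengths are computed in the description of the affine Weyl group by affine permutations. Number the vectors
  \<open>t\<^sup>e e\<^sub>j\<close> by the integers \<open>j + 3e\<close>; a monomial matrix then has a window, the
  triple of the integers of its rows. Multiplying on the left by a simple reflection swaps two neighbours in the
  window, extended by \<open>3\<close>-periodicity, and Shi's inversion count changes by exactly one
  (\<open>Shi_length_reflection\<close>). Hence the inversion count is a lower bound for the Coxeter length, and every
  window with sum \<open>6\<close>, the value for determinant \<open>1\<close>, is reached by a word in the simple
  reflections, because a window without descents is the window \<open>1, 2, 3\<close> of the identity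
  (\<open>exists_affine_Weyl_element\<close>).
\<close>

section \<open>Three by three matrices\<close>

definition mat3 :: "F \<Rightarrow> F \<Rightarrow> F \<Rightarrow> F \<Rightarrow> F \<Rightarrow> F \<Rightarrow> F \<Rightarrow> F \<Rightarrow> F \<Rightarrow> matF"
  where "mat3 a b c d e f g h i = vector [vector [a, b, c], vector [d, e, f], vector [g, h, i]]"

abbreviation diag3 :: "F \<Rightarrow> F \<Rightarrow> F \<Rightarrow> matF"
  where "diag3 x y z \<equiv> mat3 x 0 0 0 y 0 0 0 z"

lemma mult_row:
  fixes M N :: matF
  shows "(M ** N)$i = M$i$1 *s N$1 + M$i$2 *s N$2 + M$i$3 *s N$3"
  by (simp add: vec_eq_iff mult_3)

section \<open>Windows of monomial matrices\<close>

text \<open>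
  The vector \<open>t\<^sup>e e\<^sub>j\<close> with \<open>j \<in> {1, 2, 3}\<close> has the number \<open>z = j + 3e\<close>, so that
  \<open>j = col z\<close> and \<open>e = (z - 1) div 3\<close>.
\<close>

definition col :: "int \<Rightarrow> 3"
  where "col z = (if z mod 3 = 1 then 1 else if z mod 3 = 2 then 2 else 3)"

text \<open>
  Only the valuation of the nonzero entry is recorded: windows are to be insensitive to the torus and
  to the diagonal matrices with unit entries in \<open>A\<close>.
\<close>

definition monomial_row :: "F^3 \<Rightarrow> int \<Rightarrow> bool"
  where "monomial_row r z \<longleftrightarrow>
    (\<forall>j. r$j \<noteq> 0 \<longleftrightarrow> j = col z) \<and> fls_subdegree (r$(col z)) = (z - 1) div 3"

definition has_window :: "matF \<Rightarrow> int \<Rightarrow> int \<Rightarrow> int \<Rightarrow> bool"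
  where "has_window M a b c \<longleftrightarrow> monomial_row (M$1) a \<and> monomial_row (M$2) b \<and> monomial_row (M$3) c"

lemma col_eq_iff: "col a = col b \<longleftrightarrow> a mod 3 = b mod 3"
proof -
  have "z mod 3 = 0 \<or> z mod 3 = 1 \<or> z mod 3 = 2" for z :: int by presburger
  from this[of a] this[of b] show ?thesis by (auto simp: col_def)
qed

lemma monomial_row_unique:
  assumes "monomial_row r a" "monomial_row r b"
  shows "a = b"
proof -
  have "col a = col b" using assms by (auto simp: monomial_row_def)
  then have "a mod 3 = b mod 3" "(a - 1) div 3 = (b - 1) div 3"
    using assms \<open>col a = col b\<close> by (simp_all add: monomial_row_def flip: col_eq_iff)
  then show ?thesis by presburger
qed

lemma has_window_unique:
  assumes "has_window M a b c" "has_window M a' b' c'"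
  shows "a' = a \<and> b' = b \<and> c' = c"
  using assms monomial_row_unique unfolding has_window_def by blast

lemma monomial_row_scale:
  assumes "monomial_row r z" "u \<noteq> 0" "fls_subdegree u = e"
  shows "monomial_row (u *s r) (z + 3 * e)"
proof -
  have "col (z + 3 * e) = col z" by (simp add: col_eq_iff)
  moreover have "(z + 3 * e - 1) div 3 = e + (z - 1) div 3" by presburger
  ultimately show ?thesis
    using assms by (auto simp: monomial_row_def)
qed

lemma diag3_window:
  assumes "has_window M a b c" "x * y * z = 1"
    "fls_subdegree x = 0" "fls_subdegree y = 0" "fls_subdegree z = 0"
  shows "has_window (diag3 x y z ** M) a b c"
proof -
  have "x \<noteq> 0" "y \<noteq> 0" "z \<noteq> 0" using assms(2) by auto
  then show ?thesis
    using assms monomial_row_scale[of _ _ _ 0]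
    by (auto simp: has_window_def mult_row mat3_def)
qed

text \<open>
  Up to sign, \<open>s\<^sub>0\<close> exchanges \<open>t\<close> times the first row with the third row, that is, it swaps \<open>c - 3\<close>
  and \<open>a\<close>, the entries at the places \<open>0\<close> and \<open>1\<close> of the periodic extension of the window.
\<close>

lemma reflection_window:
  assumes "has_window M a b c"
  shows "has_window (s1_mat ** M) b a c"
    and "has_window (s2_mat ** M) a c b"
    and "has_window (s0_mat ** M) (c - 3) b (a + 3)"
proof -
  have M: "monomial_row (M$1) a" "monomial_row (M$2) b" "monomial_row (M$3) c"
    using assms by (auto simp: has_window_def)
  have neg: "monomial_row (- 1 *s M$1) a" "monomial_row (- 1 *s M$2) b"
    using M(1,2)[THEN monomial_row_scale, of "- 1" 0] by auto
  have "monomial_row (fls_X_inv *s M$3) (c - 3)" "monomial_row (- fls_X *s M$1) (a + 3)"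
    using monomial_row_scale[OF M(3), of "fls_X_inv" "- 1"] monomial_row_scale[OF M(1), of "- fls_X" 1]
    by auto
  with M neg show "has_window (s1_mat ** M) b a c" "has_window (s2_mat ** M) a c b"
    "has_window (s0_mat ** M) (c - 3) b (a + 3)"
    by (auto simp: has_window_def mult_row s1_mat_def s2_mat_def s0_mat_def)
qed

lemma one_window: "has_window (mat 1) 1 2 3"
  by (auto simp: has_window_def monomial_row_def col_def mat_def)

lemma monomial_row_vector:
  assumes "x \<noteq> 0" "fls_subdegree x = e"
  shows "monomial_row (vector [x, 0, 0]) (1 + 3 * e)"
    and "monomial_row (vector [0, x, 0]) (2 + 3 * e)"
    and "monomial_row (vector [0, 0, x]) (3 + 3 * e)"
proof -
  have "(2 + 3 * e - 1) div 3 = e" "(3 + 3 * e - 1) div 3 = e"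
    by presburger+
  then show "monomial_row (vector [x, 0, 0]) (1 + 3 * e)" "monomial_row (vector [0, x, 0]) (2 + 3 * e)"
    "monomial_row (vector [0, 0, x]) (3 + 3 * e)"
    using assms by (simp_all add: monomial_row_def col_def forall_3)
qed

section \<open>The length of a window\<close>

text \<open>
  The rows of a nonsingular monomial matrix meet different columns.
\<close>

definition window :: "int \<Rightarrow> int \<Rightarrow> int \<Rightarrow> bool"
  where "window a b c \<longleftrightarrow> a mod 3 \<noteq> b mod 3 \<and> b mod 3 \<noteq> c mod 3 \<and> a mod 3 \<noteq> c mod 3"

text \<open>
  Each summand counts the inversions between two entries of the window and their translates by
  multiples of \<open>3\<close>, up to a common translation.
\<close>

definition Shi_length :: "int \<Rightarrow> int \<Rightarrow> int \<Rightarrow> int"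
  where "Shi_length a b c = \<bar>(b - a) div 3\<bar> + \<bar>(c - b) div 3\<bar> + \<bar>(c - a) div 3\<bar>"

text \<open>
  The first equation is for a pair that \<open>s\<^sub>1\<close> or \<open>s\<^sub>2\<close> reverses. Under \<open>s\<^sub>0\<close> every pair is reversed; the
  difference then grows by \<open>3\<close> for the pairs that contain the middle entry and by \<open>6\<close> for the outer pair.
\<close>

lemma abs_div3_uminus:
  fixes x :: int
  assumes "x mod 3 \<noteq> 0"
  shows "\<bar>(- x) div 3\<bar> = \<bar>x div 3\<bar> + (if 0 < x then 1 else - 1)"
    and "\<bar>(- x) div 3 + 1\<bar> = \<bar>x div 3\<bar>"
    and "\<bar>(- x) div 3 + 2\<bar> = \<bar>x div 3\<bar> + (if x < 3 then 1 else - 1)"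
proof -
  have neg: "(- x) div 3 = - (x div 3) - 1" using assms by presburger
  have pos: "0 < x \<longleftrightarrow> 0 \<le> x div 3" "x < 3 \<longleftrightarrow> x div 3 \<le> 0" using assms by presburger+
  show "\<bar>(- x) div 3\<bar> = \<bar>x div 3\<bar> + (if 0 < x then 1 else - 1)"
    "\<bar>(- x) div 3 + 1\<bar> = \<bar>x div 3\<bar>"
    "\<bar>(- x) div 3 + 2\<bar> = \<bar>x div 3\<bar> + (if x < 3 then 1 else - 1)"
    unfolding neg pos by auto
qed

text \<open>
  A simple reflection swaps two neighbours of the periodic window. It creates or removes the one
  inversion between them and permutes all others.
\<close>

lemma Shi_length_reflection:
  assumes "window a b c"
  shows "Shi_length b a c = Shi_length a b c + (if a < b then 1 else - 1)"
    and "Shi_length a c b = Shi_length a b c + (if b < c then 1 else - 1)"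
    and "Shi_length (c - 3) b (a + 3) = Shi_length a b c + (if c < a + 3 then 1 else - 1)"
proof -
  have m: "(b - a) mod 3 \<noteq> 0" "(c - b) mod 3 \<noteq> 0" "(c - a) mod 3 \<noteq> 0"
    using assms by (auto simp: window_def mod_eq_dvd_iff mod_eq_0_iff_dvd dest: dvd_diff_commute[THEN iffD1])
  have swap: "\<bar>(a - b) div 3\<bar> = \<bar>(b - a) div 3\<bar> + (if a < b then 1 else - 1)"
    "\<bar>(b - c) div 3\<bar> = \<bar>(c - b) div 3\<bar> + (if b < c then 1 else - 1)"
    using m(1,2)[THEN abs_div3_uminus(1)] by (simp_all only: minus_diff_eq diff_gt_0_iff_gt)
  show "Shi_length b a c = Shi_length a b c + (if a < b then 1 else - 1)"
    "Shi_length a c b = Shi_length a b c + (if b < c then 1 else - 1)"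
    unfolding Shi_length_def swap by (simp_all only: ac_simps)
  have eqs: "b - (c - 3) = - (c - b) + 3" "a + 3 - b = - (b - a) + 3" "a + 3 - (c - 3) = - (c - a) + 6"
    "c - a < 3 \<longleftrightarrow> c < a + 3"
    by linarith+
  have shift: "(x + 3) div 3 = x div 3 + 1" "(x + 6) div 3 = x div 3 + 2" for x :: int
    by presburger+
  show "Shi_length (c - 3) b (a + 3) = Shi_length a b c + (if c < a + 3 then 1 else - 1)"
    unfolding Shi_length_def eqs(1-3) shift m[THEN abs_div3_uminus(2)] m[THEN abs_div3_uminus(3)] eqs(4)
    by (simp only: ac_simps)
qed

lemma window_reflection:
  assumes "window a b c"
  shows "window b a c" "window a c b" "window (c - 3) b (a + 3)"
proof -
  show "window b a c" "window a c b" using assms by (auto simp: window_def)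
  have "(c - 3) mod 3 = c mod 3" by presburger
  then show "window (c - 3) b (a + 3)" using assms by (auto simp: window_def)
qed

lemma increasing_window:
  fixes a b c :: int
  assumes "a + b + c = 6" "a < b" "b < c" "c < a + 3"
  shows "a = 1 \<and> b = 2 \<and> c = 3"
  using assms by linarith

text \<open>
  Three increasing integers within less than one period are consecutive, and the sum then fixes them.
  Hence any other window can be shortened by a simple reflection.
\<close>

lemma window_descent:
  assumes "window a b c" "a + b + c = 6"
  obtains "a = 1" "b = 2" "c = 3" | "b < a" | "c < b" | "a + 3 < c"
proof -
  have "a \<noteq> b" "b \<noteq> c" "c \<noteq> a + 3"
    using assms(1) by (auto simp: window_def)
  then show ?thesis
    using that increasing_window[OF assms(2)] by linarith
qed

lemma exists_word_with_window:
  assumes "window a b c" "a + b + c = 6"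
  shows "\<exists>ss. set ss \<subseteq> {s0_mat, s1_mat, s2_mat} \<and> has_window (foldr (**) ss (mat 1)) a b c"
  using assms
proof (induction "nat (Shi_length a b c)" arbitrary: a b c rule: less_induct)
  case less
  have nonneg: "0 \<le> Shi_length x y z" for x y z by (simp add: Shi_length_def)
  have extend: "\<exists>ss. set ss \<subseteq> {s0_mat, s1_mat, s2_mat} \<and> has_window (foldr (**) ss (mat 1)) a b c"
    if s: "s \<in> {s0_mat, s1_mat, s2_mat}"
      and step: "\<And>M. has_window M x y z \<Longrightarrow> has_window (s ** M) a b c"
      and xyz: "window x y z" "x + y + z = 6" "Shi_length x y z = Shi_length a b c - 1" for s x y z
  proof -
    have "nat (Shi_length x y z) < nat (Shi_length a b c)"
      using xyz(3) nonneg[of x y z] by linarith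
    then obtain ss where "set ss \<subseteq> {s0_mat, s1_mat, s2_mat}" "has_window (foldr (**) ss (mat 1)) x y z"
      using less.hyps xyz(1,2) by blast
    then show ?thesis using s step by (intro exI[of _ "s # ss"]) auto
  qed
  note len = Shi_length_reflection[OF less.prems(1)] and win = window_reflection[OF less.prems(1)]
  from less.prems show ?case
  proof (cases rule: window_descent)
    case 1
    then show ?thesis using one_window by (intro exI[of _ "[]"]) simp
  next
    case 2
    then show ?thesis
      using extend[of s1_mat b a c] reflection_window(1)[of _ b a c] len(1) win(1) less.prems(2) by simp
  next
    case 3
    then show ?thesis
      using extend[of s2_mat a c b] reflection_window(2)[of _ a c b] len(2) win(2) less.prems(2) by simp
  next
    case 4
    then show ?thesis
      using extend[of s0_mat "c - 3" b "a + 3"] reflection_window(3)[of _ "c - 3" b "a + 3"] len(3) win(3) less.prems(2)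
      by simp
  qed
qed

section \<open>The affine Weyl group\<close>

lemma torus_eq:
  assumes "0 \<in> R"
  shows "torus R = {diag3 x y z | x y z. x \<in> R \<and> y \<in> R \<and> z \<in> R \<and> x * y * z = 1}"
proof (intro equalityI subsetI)
  fix M assume M: "M \<in> torus R"
  then have off: "M$1$2 = 0" "M$1$3 = 0" "M$2$1 = 0" "M$2$3 = 0" "M$3$1 = 0" "M$3$2 = 0"
    by (simp_all add: torus_def)
  moreover have "M = diag3 (M$1$1) (M$2$2) (M$3$3)"
    using off by (simp add: vec_eq_iff forall_3 mat3_def)
  moreover have "det M = 1" "\<And>i j. M$i$j \<in> R" using M by (auto simp: torus_def SL3_def)
  ultimately show "M \<in> {diag3 x y z | x y z. x \<in> R \<and> y \<in> R \<and> z \<in> R \<and> x * y * z = 1}"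
    unfolding det_3 by (simp; metis)
next
  fix M assume "M \<in> {diag3 x y z | x y z. x \<in> R \<and> y \<in> R \<and> z \<in> R \<and> x * y * z = 1}"
  then show "M \<in> torus R"
    using assms by (auto simp: torus_def SL3_def det_3 forall_3 mat3_def)
qed

lemma reflection_diag3:
  "s1_mat ** diag3 x y z = diag3 y x z ** s1_mat"
  "s2_mat ** diag3 x y z = diag3 x z y ** s2_mat"
  "s0_mat ** diag3 x y z = diag3 z y x ** s0_mat"
  by (simp_all add: vec_eq_iff forall_3 mult_3 s1_mat_def s2_mat_def s0_mat_def mat3_def)

text \<open>
  Conjugation by a simple reflection permutes the three diagonal entries. The statement is used over
  \<open>K[t, t\<^sup>-\<^sup>1]\<close>, to see that the reflections lie in \<open>N\<close>, and over \<open>K\<close>, to multiply cosets of the torus.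
\<close>

lemma reflection_torus_commute:
  assumes "0 \<in> R" "s \<in> {s0_mat, s1_mat, s2_mat}"
  shows "(**) s ` torus R = (\<lambda>t. t ** s) ` torus R"
proof -
  have swap: "\<exists>t'\<in>torus R. s ** t = t' ** s \<and> s ** t' = t ** s" if t_torus: "t \<in> torus R" for t
  proof -
    obtain x y z where t: "t = diag3 x y z" "x \<in> R" "y \<in> R" "z \<in> R" "x * y * z = 1"
      using t_torus unfolding torus_eq[OF assms(1)] by blast
    have perm: "y * x * z = 1" "x * z * y = 1" "z * y * x = 1"
      using t(5) by (simp_all only: mult_ac)
    have "diag3 y x z \<in> torus R" "diag3 x z y \<in> torus R" "diag3 z y x \<in> torus R"
      unfolding torus_eq[OF assms(1)] using t(2-4) perm by blast+
    then show ?thesis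
      using assms(2) reflection_diag3 unfolding t(1) by blast
  qed
  show ?thesis
  proof (intro equalityI image_subsetI)
    fix t assume "t \<in> torus R"
    from swap[OF this] show "s ** t \<in> (\<lambda>t. t ** s) ` torus R" "t ** s \<in> (**) s ` torus R"
      by (metis image_eqI)+
  qed
qed

lemma Laurent_poly_ring_closed:
  "0 \<in> Laurent_poly_ring" "1 \<in> Laurent_poly_ring"
  "x \<in> Laurent_poly_ring \<Longrightarrow> y \<in> Laurent_poly_ring \<Longrightarrow> x + y \<in> Laurent_poly_ring"
  "x \<in> Laurent_poly_ring \<Longrightarrow> y \<in> Laurent_poly_ring \<Longrightarrow> x - y \<in> Laurent_poly_ring"
  "x \<in> Laurent_poly_ring \<Longrightarrow> y \<in> Laurent_poly_ring \<Longrightarrow> x * y \<in> Laurent_poly_ring"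
proof -
  show "0 \<in> Laurent_poly_ring" "1 \<in> Laurent_poly_ring"
    by (simp_all add: Laurent_poly_ring_def)
  assume x: "x \<in> Laurent_poly_ring" and y: "y \<in> Laurent_poly_ring"
  have "finite ({n. fls_nth x n \<noteq> 0} \<union> {n. fls_nth y n \<noteq> 0})"
    using x y by (simp add: Laurent_poly_ring_def)
  then have "finite {n. fls_nth (x + y) n \<noteq> 0}" "finite {n. fls_nth (x - y) n \<noteq> 0}"
    by (rule rev_finite_subset; force)+
  then show "x + y \<in> Laurent_poly_ring" "x - y \<in> Laurent_poly_ring"
    by (simp_all add: Laurent_poly_ring_def)
  have "{n. fls_nth (x * y) n \<noteq> 0}
      \<subseteq> (\<lambda>(i, j). i + j) ` ({n. fls_nth x n \<noteq> 0} \<times> {n. fls_nth y n \<noteq> 0})"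
  proof
    fix n assume "n \<in> {n. fls_nth (x * y) n \<noteq> 0}"
    then obtain i where "fls_nth x i * fls_nth y (n - i) \<noteq> 0"
      unfolding fls_times_nth(2) by (auto elim: sum.not_neutral_contains_not_neutral)
    then show "n \<in> (\<lambda>(i, j). i + j) ` ({n. fls_nth x n \<noteq> 0} \<times> {n. fls_nth y n \<noteq> 0})"
      by (intro image_eqI[of _ _ "(i, n - i)"]) auto
  qed
  then show "x * y \<in> Laurent_poly_ring"
    using x y unfolding Laurent_poly_ring_def by (auto intro: finite_subset)
qed

text \<open>
  The inverse is the adjugate matrix, whose entries are polynomials in those of the matrix.
\<close>

lemma group_SL3:
  assumes "0 \<in> R" "1 \<in> R"
    and "\<And>x y. x \<in> R \<Longrightarrow> y \<in> R \<Longrightarrow> x + y \<in> R"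
    and "\<And>x y. x \<in> R \<Longrightarrow> y \<in> R \<Longrightarrow> x - y \<in> R"
    and "\<And>x y. x \<in> R \<Longrightarrow> y \<in> R \<Longrightarrow> x * y \<in> R"
  shows "group (SL3 R)"
proof (rule groupI)
  fix M assume M: "M \<in> carrier (SL3 R)"
  define C :: matF where "C = vector [
    vector [M$2$2 * M$3$3 - M$2$3 * M$3$2, M$1$3 * M$3$2 - M$1$2 * M$3$3, M$1$2 * M$2$3 - M$1$3 * M$2$2],
    vector [M$2$3 * M$3$1 - M$2$1 * M$3$3, M$1$1 * M$3$3 - M$1$3 * M$3$1, M$1$3 * M$2$1 - M$1$1 * M$2$3],
    vector [M$2$1 * M$3$2 - M$2$2 * M$3$1, M$1$2 * M$3$1 - M$1$1 * M$3$2, M$1$1 * M$2$2 - M$1$2 * M$2$1]]"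
  have det: "det M = 1" and R: "\<And>i j. M$i$j \<in> R" using M by (auto simp: SL3_def)
  have CM: "C ** M = mat 1"
    using det by (simp add: vec_eq_iff forall_3 mult_3 C_def mat_def det_3) (simp add: algebra_simps)
  then have "det C = 1" using det by (metis det_I det_mul mult.right_neutral)
  moreover have "\<forall>i j. C$i$j \<in> R"
    unfolding forall_3 C_def using R by (simp add: assms)
  ultimately show "\<exists>C\<in>carrier (SL3 R). C \<otimes>\<^bsub>SL3 R\<^esub> M = \<one>\<^bsub>SL3 R\<^esub>"
    using CM by (auto simp: SL3_def)
next
  show "\<one>\<^bsub>SL3 R\<^esub> \<in> carrier (SL3 R)"
    using assms(1,2) by (auto simp: SL3_def mat_def det_I[unfolded mat_def])
qed (auto simp: SL3_def det_mul mult_3 assms matrix_mul_assoc)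

lemma group_SL3_Laurent: "group (SL3 Laurent_poly_ring)"
  by (rule group_SL3) (simp_all add: Laurent_poly_ring_closed)

lemma torus_subset_carrier: "torus R \<subseteq> carrier (SL3 R)"
  by (auto simp: torus_def)

lemma reflection_in_normalizer:
  assumes "s \<in> {s0_mat, s1_mat, s2_mat}"
  shows "s \<in> normalizer (SL3 Laurent_poly_ring) (torus Laurent_poly_ring)"
proof -
  let ?G = "SL3 Laurent_poly_ring" and ?T = "torus Laurent_poly_ring"
  interpret group ?G by (rule group_SL3_Laurent)
  have "{n. fls_nth fls_X_inv n \<noteq> (0::complex)} = {- 1}" "{n. fls_nth (- fls_X) n \<noteq> (0::complex)} = {1}"
    by auto
  then have "fls_X_inv \<in> Laurent_poly_ring" "- fls_X \<in> Laurent_poly_ring"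
    unfolding Laurent_poly_ring_def by simp_all
  moreover have "- 1 \<in> Laurent_poly_ring"
    using Laurent_poly_ring_closed(4)[of 0 1] Laurent_poly_ring_closed(1,2) by simp
  ultimately have s: "s \<in> carrier ?G"
    using assms Laurent_poly_ring_closed(1,2)
    by (auto simp: SL3_def det_3 forall_3 s0_mat_def s1_mat_def s2_mat_def fls_X_inv_times_conv_shift)
  have "s <#\<^bsub>?G\<^esub> ?T = ?T #>\<^bsub>?G\<^esub> s"
    using reflection_torus_commute[OF Laurent_poly_ring_closed(1) assms]
    by (auto simp: l_coset_def r_coset_def SL3_def)
  then have "s <#\<^bsub>?G\<^esub> ?T #>\<^bsub>?G\<^esub> inv\<^bsub>?G\<^esub> s = ?T"
    using s torus_subset_carrier coset_mult_assoc coset_mult_one by simp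
  then show ?thesis
    using s torus_subset_carrier by (simp add: normalizer_def stabilizer_def)
qed

lemma word_in_normalizer:
  assumes "set ss \<subseteq> {s0_mat, s1_mat, s2_mat}"
  shows "foldr (**) ss (mat 1) \<in> carrier (torus_normalizer Laurent_poly_ring)"
proof -
  let ?G = "SL3 Laurent_poly_ring" and ?T = "torus Laurent_poly_ring"
  interpret subgroup "normalizer ?G ?T" ?G
    using group.normalizer_imp_subgroup[OF group_SL3_Laurent torus_subset_carrier] .
  have "foldr (**) ss (mat 1) \<in> normalizer ?G ?T"
    using assms
  proof (induction ss)
    case Nil
    then show ?case using one_closed by (simp add: SL3_def)
  next
    case (Cons s ss)
    then show ?case
      using m_closed[OF reflection_in_normalizer[of s]] by (simp add: SL3_def)
  qed
  then show ?thesis by (simp add: torus_normalizer_def)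
qed

lemma r_coset_torus_normalizer: "S #>\<^bsub>torus_normalizer R\<^esub> M = (\<lambda>t. t ** M) ` S"
  by (auto simp: r_coset_def torus_normalizer_def SL3_def)

lemma affine_Weyl_mult: "mult affine_Weyl U V = {u ** v | u v. u \<in> U \<and> v \<in> V}"
  by (auto simp: affine_Weyl_def FactGroup_def set_mult_def torus_normalizer_def SL3_def)

lemma affine_Weyl_one: "one affine_Weyl = torus K_ring"
  by (simp add: affine_Weyl_def FactGroup_def)

lemma torus_K_mult: "t \<in> torus K_ring \<Longrightarrow> u \<in> torus K_ring \<Longrightarrow> t ** u \<in> torus K_ring"
proof -
  assume "t \<in> torus K_ring" "u \<in> torus K_ring"
  then obtain x y z x' y' z' where t: "t = diag3 x y z" "x \<in> K_ring" "y \<in> K_ring" "z \<in> K_ring" "x * y * z = 1"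
      and u: "u = diag3 x' y' z'" "x' \<in> K_ring" "y' \<in> K_ring" "z' \<in> K_ring" "x' * y' * z' = 1"
    unfolding torus_eq[OF K_ring_closed(1)] by blast
  have "t ** u = diag3 (x * x') (y * y') (z * z')"
    by (simp add: t(1) u(1) mat3_def vec_eq_iff forall_3 mult_3)
  moreover have "x * x' * (y * y') * (z * z') = (x * y * z) * (x' * y' * z')"
    by (simp only: mult_ac)
  then have "x * x' * (y * y') * (z * z') = 1" unfolding t(5) u(5) by simp
  moreover have "x * x' \<in> K_ring" "y * y' \<in> K_ring" "z * z' \<in> K_ring"
    using t(2-4) u(2-4) K_ring_closed(3) by blast+
  ultimately show ?thesis
    unfolding torus_eq[OF K_ring_closed(1)] by blast
qed

lemma one_in_torus: "mat 1 \<in> torus K_ring"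
  by (auto simp: torus_def SL3_def mat_def K_ring_closed det_I[unfolded mat_def])

text \<open>
  The factors from the torus can be moved to the left through the simple reflections, so the product of the
  cosets is the coset of the product of the matrices.
\<close>

lemma word_coset:
  assumes "set ss \<subseteq> {s0_mat, s1_mat, s2_mat}"
  shows "foldr (mult affine_Weyl) (map (\<lambda>s. (\<lambda>t. t ** s) ` torus K_ring) ss) (one affine_Weyl)
    = (\<lambda>t. t ** foldr (**) ss (mat 1)) ` torus K_ring"
  using assms
proof (induction ss)
  case Nil
  then show ?case by (simp add: affine_Weyl_one)
next
  case (Cons s ss)
  let ?T = "torus K_ring" and ?M = "foldr (**) ss (mat 1)"
  have move: "\<exists>t'\<in>?T. s ** t = t' ** s" if "t \<in> ?T" for t
    using reflection_torus_commute[OF K_ring_closed(1), of s] Cons.prems that by (auto simp: image_def)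
  have "{u ** v | u v. u \<in> (\<lambda>t. t ** s) ` ?T \<and> v \<in> (\<lambda>t. t ** ?M) ` ?T} = (\<lambda>t. t ** (s ** ?M)) ` ?T"
  proof (intro equalityI subsetI)
    fix N assume "N \<in> {u ** v | u v. u \<in> (\<lambda>t. t ** s) ` ?T \<and> v \<in> (\<lambda>t. t ** ?M) ` ?T}"
    then obtain t u where tu: "t \<in> ?T" "u \<in> ?T" "N = (t ** s) ** (u ** ?M)" by blast
    then obtain u' where "u' \<in> ?T" "s ** u = u' ** s" using move by blast
    then have "N = (t ** u') ** (s ** ?M)"
      unfolding tu(3) by (metis matrix_mul_assoc)
    then show "N \<in> (\<lambda>t. t ** (s ** ?M)) ` ?T"
      using torus_K_mult[OF tu(1) \<open>u' \<in> ?T\<close>] by blast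
  next
    fix N assume "N \<in> (\<lambda>t. t ** (s ** ?M)) ` ?T"
    then obtain t where "t \<in> ?T" "N = (t ** s) ** (mat 1 ** ?M)"
      by (auto simp: matrix_mul_assoc)
    then show "N \<in> {u ** v | u v. u \<in> (\<lambda>t. t ** s) ` ?T \<and> v \<in> (\<lambda>t. t ** ?M) ` ?T}"
      using one_in_torus by blast
  qed
  then show ?case
    using Cons by (simp add: affine_Weyl_mult)
qed

lemma torus_K_window:
  assumes "t \<in> torus K_ring" "has_window M a b c"
  shows "has_window (t ** M) a b c"
proof -
  obtain x y z where "t = diag3 x y z" "x \<in> K_ring" "y \<in> K_ring" "z \<in> K_ring" "x * y * z = 1"
    using assms(1) unfolding torus_eq[OF K_ring_closed(1)] by blast
  then show ?thesis
    using diag3_window[OF assms(2)] by (auto simp: K_ring_def)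
qed

text \<open>
  The factors from the torus do not affect the window, and each reflection raises the inversion count by at
  most one.
\<close>

lemma word_window_length:
  assumes "set ss \<subseteq> simple_reflections" "M \<in> foldr (mult affine_Weyl) ss (one affine_Weyl)"
  shows "\<exists>a b c. has_window M a b c \<and> window a b c \<and> Shi_length a b c \<le> int (length ss)"
  using assms
proof (induction ss arbitrary: M)
  case Nil
  then have "has_window M 1 2 3"
    using torus_K_window[OF _ one_window, of M] by (simp add: affine_Weyl_one)
  moreover have "window 1 2 3" "Shi_length 1 2 3 = 0" by (simp_all add: window_def Shi_length_def)
  ultimately show ?case by (metis list.size(3) of_nat_0 order_refl)
next
  case (Cons r ss)
  obtain s where s: "s \<in> {s0_mat, s1_mat, s2_mat}" "r = (\<lambda>t. t ** s) ` torus K_ring"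
    using Cons.prems(1) by (auto simp: simple_reflections_def r_coset_torus_normalizer)
  have "M \<in> mult affine_Weyl r (foldr (mult affine_Weyl) ss (one affine_Weyl))"
    using Cons.prems(2) by simp
  then obtain t N where tN: "t \<in> torus K_ring" "M = t ** (s ** N)"
      "N \<in> foldr (mult affine_Weyl) ss (one affine_Weyl)"
    unfolding affine_Weyl_mult s(2) by (auto simp: matrix_mul_assoc)
  then obtain a b c where abc: "has_window N a b c" "window a b c" "Shi_length a b c \<le> int (length ss)"
    using Cons.IH[of N] Cons.prems(1) by (meson list.set_intros(2) subset_iff)
  note len = Shi_length_reflection[OF abc(2)] and win = window_reflection[OF abc(2)]
  have "\<exists>a' b' c'. has_window (s ** N) a' b' c' \<and> window a' b' c' \<and> Shi_length a' b' c' \<le> Shi_length a b c + 1"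
  proof -
    consider "s = s0_mat" | "s = s1_mat" | "s = s2_mat" using s(1) by auto
    then show ?thesis
    proof cases
      case 1
      show ?thesis
        by (intro exI[of _ "c - 3"] exI[of _ b] exI[of _ "a + 3"])
          (simp add: 1 reflection_window(3)[OF abc(1)] win len)
    next
      case 2
      show ?thesis
        by (intro exI[of _ b] exI[of _ a] exI[of _ c])
          (simp add: 2 reflection_window(1)[OF abc(1)] win len)
    next
      case 3
      show ?thesis
        by (intro exI[of _ a] exI[of _ c] exI[of _ b])
          (simp add: 3 reflection_window(2)[OF abc(1)] win len)
    qed
  qed
  then obtain a' b' c' where "has_window (s ** N) a' b' c'" "window a' b' c'"
      "Shi_length a' b' c' \<le> Shi_length a b c + 1"
    by blast
  then have "has_window M a' b' c' \<and> window a' b' c' \<and> Shi_length a' b' c' \<le> int (length (r # ss))"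
    using torus_K_window[OF tN(1)] tN(2) abc(3) by auto
  then show ?case by blast
qed

text \<open>
  The Coxeter length is the least length of a word for the coset. That there is a word at all is
  \<open>exists_word_with_window\<close>; a shortest one bounds the inversion count through \<open>word_window_length\<close>, since a
  matrix determines its window.
\<close>

lemma exists_affine_Weyl_element:
  assumes "window a b c" "a + b + c = 6"
  obtains M where "has_window M a b c" "det M = 1"
    "(\<lambda>t. t ** M) ` torus K_ring \<in> carrier affine_Weyl"
    "Shi_length a b c \<le> int (Coxeter_length ((\<lambda>t. t ** M) ` torus K_ring))"
proof -
  obtain ss where ss: "set ss \<subseteq> {s0_mat, s1_mat, s2_mat}" "has_window (foldr (**) ss (mat 1)) a b c"
    using exists_word_with_window[OF assms] by blast
  define M where "M = foldr (**) ss (mat 1)"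
  define w where "w = (\<lambda>t. t ** M) ` torus K_ring"
  have norm: "M \<in> carrier (torus_normalizer Laurent_poly_ring)"
    unfolding M_def by (rule word_in_normalizer[OF ss(1)])
  then have "det M = 1"
    by (auto simp: torus_normalizer_def normalizer_def stabilizer_def SL3_def)
  have "w \<in> carrier affine_Weyl"
    using norm by (auto simp: affine_Weyl_def FactGroup_def RCOSETS_def r_coset_torus_normalizer w_def)
  let ?word = "\<lambda>n ss. length ss = n \<and> set ss \<subseteq> simple_reflections \<and>
    w = foldr (mult affine_Weyl) ss (one affine_Weyl)"
  have "?word (length ss) (map (\<lambda>s. (\<lambda>t. t ** s) ` torus K_ring) ss)"
    using ss(1) unfolding w_def M_def word_coset[OF ss(1)]
    by (auto simp: simple_reflections_def r_coset_torus_normalizer)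
  then have "\<exists>n ss. ?word n ss" by blast
  then have "\<exists>ss. ?word (Coxeter_length w) ss"
    unfolding Coxeter_length_def by (rule LeastI_ex)
  then obtain ss' where ss': "?word (Coxeter_length w) ss'" by blast
  have "M \<in> w"
    unfolding w_def using one_in_torus by (metis image_eqI matrix_mul_lid)
  then have "Shi_length a b c \<le> int (Coxeter_length w)"
    using word_window_length[of ss' M] ss' has_window_unique[OF ss(2)] unfolding M_def by metis
  then show thesis
    using that[of M] ss(2) \<open>det M = 1\<close> \<open>w \<in> carrier affine_Weyl\<close> unfolding w_def M_def by blast
qed

section \<open>Bruhat cells of monomial matrices\<close>

lemma A_ring_iff: "x \<in> A_ring \<longleftrightarrow> 0 \<le> fls_subdegree x"
proof
  assume "0 \<le> fls_subdegree x"
  then have "x = fps_to_fls (fls_regpart x)" by simp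
  then show "x \<in> A_ring" unfolding A_ring_def by (rule range_eqI)
qed (auto simp: A_ring_def fls_subdegree_fls_to_fps_gt0)

text \<open>
  That the reduction modulo \<open>t\<close> has determinant \<open>1\<close> follows from \<open>det M = 1\<close>, because taking the constant
  coefficient is a ring homomorphism on \<open>A\<close>.
\<close>

lemma IwahoriI:
  assumes "det M = 1" "\<And>i j. M$i$j \<in> A_ring"
    "fls_nth (M$2$1) 0 = 0" "fls_nth (M$3$1) 0 = 0" "fls_nth (M$3$2) 0 = 0"
  shows "M \<in> Iwahori"
proof -
  have "fls_nth (det M) 0 = det (\<chi> i j. fls_nth (M$i$j) 0)"
    unfolding det_3 using assms(2) by (simp add: A_ring_nth0_mult A_ring_closed)
  moreover have "det (reduce0 M) = fls_const (det (\<chi> i j. fls_nth (M$i$j) 0))"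
    unfolding det_3
    by (simp add: reduce0_def fls_const_mult_const fls_plus_const fls_minus_const)
  ultimately have "det (reduce0 M) = 1"
    using assms(1) by simp
  then show ?thesis
    using assms by (auto simp: Iwahori_def Borel_def SL3_def reduce0_def K_ring_def)
qed

lemma diag3_Iwahori:
  assumes "x * y * z = 1" "fls_subdegree x = 0" "fls_subdegree y = 0" "fls_subdegree z = 0"
  shows "diag3 x y z \<in> Iwahori"
proof (rule IwahoriI)
  have "\<forall>i j. diag3 x y z $ i $ j \<in> A_ring"
    using assms(2-4) by (simp add: forall_3 mat3_def A_ring_iff)
  then show "diag3 x y z $ i $ j \<in> A_ring" for i j by blast
qed (use assms in \<open>simp_all add: det_3 mat3_def\<close>)

lemma mat3_Iwahori:
  assumes "det (mat3 a b c d e f g h i) = 1"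
    and "0 \<le> fls_subdegree a" "0 \<le> fls_subdegree b" "0 \<le> fls_subdegree c"
      "0 \<le> fls_subdegree e" "0 \<le> fls_subdegree f" "0 \<le> fls_subdegree i"
    and "d = 0 \<or> 0 < fls_subdegree d" "g = 0 \<or> 0 < fls_subdegree g" "h = 0 \<or> 0 < fls_subdegree h"
  shows "mat3 a b c d e f g h i \<in> Iwahori"
proof (rule IwahoriI)
  have "\<forall>j k. mat3 a b c d e f g h i $ j $ k \<in> A_ring"
    using assms(2-) by (auto simp: forall_3 mat3_def A_ring_iff)
  then show "mat3 a b c d e f g h i $ j $ k \<in> A_ring" for j k by blast
qed (use assms in \<open>auto simp: mat3_def\<close>)

lemma monomial_row_ratio:
  assumes "monomial_row r z" "monomial_row s z"
  obtains u where "u \<noteq> 0" "fls_subdegree u = 0" "s = u *s r"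
proof -
  have r: "r$(col z) \<noteq> 0" "s$(col z) \<noteq> 0" "fls_subdegree (s$(col z)) = fls_subdegree (r$(col z))"
    using assms by (auto simp: monomial_row_def)
  define u where "u = s$(col z) / r$(col z)"
  have off: "r$j = 0" "s$j = 0" if "j \<noteq> col z" for j
    using assms that unfolding monomial_row_def by blast+
  have "s$j = u * r$j" for j
    using r off by (cases "j = col z") (simp_all add: u_def)
  then have "s = u *s r" by (simp add: vec_eq_iff)
  moreover have "u \<noteq> 0" "fls_subdegree u = 0"
    using r by (auto simp: u_def fls_divide_subdegree)
  ultimately show thesis using that by blast
qed

text \<open>
  Corresponding rows are proportional with a factor of valuation \<open>0\<close>, and the determinants force the
  product of the three factors to be \<open>1\<close>.
\<close>

lemma same_window_Iwahori:
  assumes "has_window M a b c" "has_window N a b c" "det M = 1" "det N = 1"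
  obtains D where "D \<in> Iwahori" "N = D ** M"
proof -
  obtain x y z where xyz: "N$1 = x *s M$1" "N$2 = y *s M$2" "N$3 = z *s M$3"
      "fls_subdegree x = 0" "fls_subdegree y = 0" "fls_subdegree z = 0"
    using assms(1,2) unfolding has_window_def by (metis monomial_row_ratio)
  have N: "N = diag3 x y z ** M"
    by (simp add: vec_eq_iff[of N] forall_3 mult_row mat3_def xyz)
  then have "det (diag3 x y z) = 1"
    using assms(3,4) by (simp add: det_mul)
  then have "x * y * z = 1" by (simp add: det_3 mat3_def)
  then show thesis using that diag3_Iwahori xyz(4-6) N by blast
qed

lemma loop_set_mult: "S <#>\<^bsub>loop_grp\<^esub> U = {x ** y | x y. x \<in> S \<and> y \<in> U}"
  by (auto simp: set_mult_def SL3_def)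

text \<open>
  A monomial matrix may have arbitrary Laurent series as entries, whereas \<open>w\<close> is represented over
  \<open>K[t, t\<^sup>-\<^sup>1]\<close>. The difference is absorbed by the Iwahori subgroup.
\<close>

lemma monomial_Bruhat_cell:
  assumes "window a b c" "a + b + c = 6" "has_window N a b c" "det N = 1" "L \<in> Iwahori" "R \<in> Iwahori"
  obtains w where "w \<in> carrier affine_Weyl" "L ** N ** R \<in> Bruhat_cell w"
    "Shi_length a b c \<le> int (Coxeter_length w)"
proof -
  obtain M where M: "has_window M a b c" "det M = 1"
      "(\<lambda>t. t ** M) ` torus K_ring \<in> carrier affine_Weyl"
      "Shi_length a b c \<le> int (Coxeter_length ((\<lambda>t. t ** M) ` torus K_ring))"
    using exists_affine_Weyl_element[OF assms(1,2)] by blast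
  obtain D where D: "D \<in> Iwahori" "N = D ** M"
    using same_window_Iwahori[OF M(1) assms(3) M(2) assms(4)] by blast
  have "M \<in> (\<lambda>t. t ** M) ` torus K_ring"
    using one_in_torus by (metis image_eqI matrix_mul_lid)
  moreover have "L ** N ** R = (L ** D) ** M ** R" by (simp add: D(2) matrix_mul_assoc)
  ultimately have "L ** N ** R \<in> Bruhat_cell ((\<lambda>t. t ** M) ` torus K_ring)"
    unfolding Bruhat_cell_def loop_set_mult using Iwahori_mult[OF assms(5) D(1)] assms(6) by blast
  then show thesis using that M(3,4) by blast
qed

section \<open>A point in a long cell\<close>

text \<open>
  The matrix is reduced by pivoting. Adding \<open>A\<close>-multiples of lower rows to upper rows, or of left columns
  to right columns, is allowed without restriction; in the opposite directions the multiples must lie in \<open>t A\<close>.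
  So a pivot in the bottom row should be the leftmost entry of least valuation in that row, among \<open>1, f, h\<close>: it is
  \<open>h\<close> if the pole of \<open>h\<close> exceeds \<open>n\<close>, and \<open>f\<close> otherwise. After the pivot \<open>h\<close>, the choice of
  the second pivot is made in the same way between \<open>f\<close> and \<open>D\<close>; after the pivot \<open>f\<close>, the pole of \<open>D\<close>
  determines it. The poles of \<open>h\<close> and \<open>D\<close> cannot both be at most \<open>n\<close>, because
  \<open>h + D = f\<^sup>2\<close> has a pole of order \<open>2n\<close>; this leaves three cases.
\<close>

lemma long_Bruhat_cell:
  assumes f: "fls_subdegree f < 0"
  shows "\<exists>w\<in>carrier affine_Weyl. mat3 0 0 1 0 (- 1) (- f) 1 f h \<in> Bruhat_cell w \<and> 6 < Coxeter_length w"
proof -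
  define D where "D = f\<^sup>2 - h"
  define n where "n = - fls_subdegree f"
  have n: "1 \<le> n" "f \<noteq> 0" "fls_subdegree f = - n" using f by (auto simp: n_def)
  have f2: "fls_subdegree (f\<^sup>2) = - (2 * n)" "f\<^sup>2 \<noteq> 0"
    using n by (simp_all add: fls_subdegree_pow)
  have cell: ?thesis
    if N: "window a b c" "a + b + c = 6" "has_window N a b c" "det N = 1" "L \<in> Iwahori" "R \<in> Iwahori"
      and eq: "L ** N ** R = mat3 0 0 1 0 (- 1) (- f) 1 f h" "6 < Shi_length a b c" for a b c L N R
  proof -
    obtain w where "w \<in> carrier affine_Weyl" "L ** N ** R \<in> Bruhat_cell w"
        "Shi_length a b c \<le> int (Coxeter_length w)"
      using monomial_Bruhat_cell[OF N] by blast
    then show ?thesis using eq by (intro bexI[of _ w]) auto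
  qed
  have residues: "(1 + 3 * x) mod 3 = 1" "(2 + 3 * x) mod 3 = 2" "(3 + 3 * x) mod 3 = 0" for x :: int
    by presburger+
  have quotients: "(1 + 3 * x) div 3 = x" "(2 + 3 * x) div 3 = x" for x :: int
    by presburger+
  note subdegrees = fls_divide_subdegree n(3)
  consider (both) "fls_subdegree h < - n" "fls_subdegree D < - n"
    | (D) "- n \<le> fls_subdegree D" | (h) "- n \<le> fls_subdegree h"
    by linarith
  then show ?thesis
  proof cases
    case both
    \<comment> \<open>Both pivots are on the diagonal, and the monomial matrix is a translation.\<close>
    define m d where "m = fls_subdegree h" and "d = fls_subdegree D"
    have md: "m \<le> - 2" "d \<le> - 2" using both n(1) by (simp_all add: m_def d_def)
    have nz: "h \<noteq> 0" "D \<noteq> 0" using both n(1) by auto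
    let ?L = "mat3 1 (- f / D) (1 / h) 0 1 (- f / h) 0 0 1"
      and ?N = "mat3 (1 / D) 0 0 0 (D / h) 0 0 0 h"
      and ?R = "mat3 1 0 0 (f / D) 1 0 (1 / h) (f / h) 1"
    show ?thesis
    proof (rule cell)
      show "window (1 + 3 * - d) (2 + 3 * (d - m)) (3 + 3 * m)"
        unfolding window_def residues by simp
      show "1 + 3 * - d + (2 + 3 * (d - m)) + (3 + 3 * m) = 6" by simp
      show "has_window ?N (1 + 3 * - d) (2 + 3 * (d - m)) (3 + 3 * m)"
        using nz unfolding has_window_def mat3_def vector_3
        by (intro conjI monomial_row_vector) (simp_all add: subdegrees m_def d_def)
      show "det ?N = 1" using nz by (simp add: det_3 mat3_def)
      show "?L \<in> Iwahori" "?R \<in> Iwahori"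
        using nz n(1,2) both by (intro mat3_Iwahori; simp add: det_3 mat3_def subdegrees)+
      show "?L ** ?N ** ?R = mat3 0 0 1 0 (- 1) (- f) 1 f h"
        using nz by (simp add: vec_eq_iff forall_3 mult_3 mat3_def field_simps)
          (simp add: D_def power2_eq_square algebra_simps)
      have diffs: "2 + 3 * (d - m) - (1 + 3 * - d) = 1 + 3 * (2 * d - m)"
        "3 + 3 * m - (2 + 3 * (d - m)) = 1 + 3 * (2 * m - d)"
        "3 + 3 * m - (1 + 3 * - d) = 2 + 3 * (m + d)" by simp_all
      have "Shi_length (1 + 3 * - d) (2 + 3 * (d - m)) (3 + 3 * m)
          = \<bar>2 * d - m\<bar> + \<bar>2 * m - d\<bar> + \<bar>m + d\<bar>"
        unfolding Shi_length_def diffs quotients by (simp only: ac_simps)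
      then show "6 < Shi_length (1 + 3 * - d) (2 + 3 * (d - m)) (3 + 3 * m)"
        using md by linarith
    qed
  next
    case D
    \<comment> \<open>The pivot \<open>h\<close> is on the diagonal; then \<open>f\<close> is chosen before \<open>D\<close>.\<close>
    have "h = f\<^sup>2 - D" by (simp add: D_def)
    then have h: "fls_subdegree h = - (2 * n)"
      using D f2 n(1) fls_subdegree_diff_eq1[of "f\<^sup>2" D] by simp
    then have nz: "h \<noteq> 0" using n(1) by auto
    let ?L = "mat3 1 (- 1 / f) (1 / h) 0 1 (- f / h) 0 0 1"
      and ?N = "mat3 0 (- 1 / f) 0 (f / h) 0 0 0 0 h"
      and ?R = "mat3 1 (D / f) 0 0 1 0 (1 / h) (f / h) 1"
    show ?thesis
    proof (rule cell)
      show "window (2 + 3 * n) (1 + 3 * n) (3 + 3 * - (2 * n))"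
        unfolding window_def residues by simp
      show "2 + 3 * n + (1 + 3 * n) + (3 + 3 * - (2 * n)) = 6" by simp
      show "has_window ?N (2 + 3 * n) (1 + 3 * n) (3 + 3 * - (2 * n))"
        using nz n(2) unfolding has_window_def mat3_def vector_3
        by (intro conjI monomial_row_vector) (simp_all add: subdegrees h)
      show "det ?N = 1" using nz n(2) by (simp add: det_3 mat3_def)
      show "?L \<in> Iwahori"
        using nz n(1,2) by (intro mat3_Iwahori; simp add: det_3 mat3_def subdegrees h)
      have "0 \<le> fls_subdegree (D / f)"
        using D n(1,2) by (cases "D = 0") (simp_all add: subdegrees)
      then show "?R \<in> Iwahori"
        using nz n(1,2) by (intro mat3_Iwahori; simp add: det_3 mat3_def subdegrees h)
      show "?L ** ?N ** ?R = mat3 0 0 1 0 (- 1) (- f) 1 f h"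
        using nz n(2) by (simp add: vec_eq_iff forall_3 mult_3 mat3_def field_simps)
          (simp add: D_def power2_eq_square algebra_simps)
      have diffs: "1 + 3 * n - (2 + 3 * n) = 2 + 3 * (- 1)"
        "3 + 3 * - (2 * n) - (1 + 3 * n) = 2 + 3 * (- (3 * n))"
        "3 + 3 * - (2 * n) - (2 + 3 * n) = 1 + 3 * (- (3 * n))" by simp_all
      have "Shi_length (2 + 3 * n) (1 + 3 * n) (3 + 3 * - (2 * n)) = 6 * n + 1"
        unfolding Shi_length_def diffs quotients using n(1) by simp
      then show "6 < Shi_length (2 + 3 * n) (1 + 3 * n) (3 + 3 * - (2 * n))"
        using n(1) by linarith
    qed
  next
    case h
    \<comment> \<open>The pivot \<open>f\<close> in the bottom row is chosen before \<open>h\<close>, and the second pivot is the entry \<open>- D / f\<close>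
      that the elimination leaves in the last column.\<close>
    then have D: "fls_subdegree D = - (2 * n)"
      unfolding D_def using f2 n(1) fls_subdegree_diff_eq1[of "f\<^sup>2" h] by simp
    then have nz: "D \<noteq> 0" using n(1) by auto
    let ?L = "mat3 1 (- f / D) 0 0 1 (- 1 / f) 0 0 1"
      and ?N = "mat3 (1 / D) 0 0 0 0 (- D / f) 0 f 0"
      and ?R = "mat3 1 0 0 (1 / f) 1 (h / f) (- 1 / D) 0 1"
    show ?thesis
    proof (rule cell)
      show "window (1 + 3 * (2 * n)) (3 + 3 * - n) (2 + 3 * - n)"
        unfolding window_def residues by simp
      show "1 + 3 * (2 * n) + (3 + 3 * - n) + (2 + 3 * - n) = 6" by simp
      show "has_window ?N (1 + 3 * (2 * n)) (3 + 3 * - n) (2 + 3 * - n)"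
        using nz n(2) unfolding has_window_def mat3_def vector_3
        by (intro conjI monomial_row_vector) (simp_all add: subdegrees D)
      show "det ?N = 1" using nz n(2) by (simp add: det_3 mat3_def)
      show "?L \<in> Iwahori"
        using nz n(1,2) by (intro mat3_Iwahori; simp add: det_3 mat3_def subdegrees D)
      have "0 \<le> fls_subdegree (h / f)"
        using h n(1,2) by (cases "h = 0") (simp_all add: subdegrees)
      then show "?R \<in> Iwahori"
        using nz n(1,2) by (intro mat3_Iwahori; simp add: det_3 mat3_def subdegrees D)
      show "?L ** ?N ** ?R = mat3 0 0 1 0 (- 1) (- f) 1 f h"
        using nz n(2) by (simp add: vec_eq_iff forall_3 mult_3 mat3_def field_simps)
          (simp add: D_def power2_eq_square algebra_simps)
      have diffs: "3 + 3 * - n - (1 + 3 * (2 * n)) = 2 + 3 * (- (3 * n))"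
        "2 + 3 * - n - (3 + 3 * - n) = 2 + 3 * (- 1)"
        "2 + 3 * - n - (1 + 3 * (2 * n)) = 1 + 3 * (- (3 * n))" by simp_all
      have "Shi_length (1 + 3 * (2 * n)) (3 + 3 * - n) (2 + 3 * - n) = 6 * n + 1"
        unfolding Shi_length_def diffs quotients using n(1) by simp
      then show "6 < Shi_length (1 + 3 * (2 * n)) (3 + 3 * - n) (2 + 3 * - n)"
        using n(1) by linarith
    qed
  qed
qed

lemma cube_strictly_upper:
  assumes "Y \<in> b_u"
  shows "Y ** (Y ** Y) = 0"
  using assms by (simp add: vec_eq_iff forall_3 mult_3 b_u_def mat_def)

text \<open>
  Since \<open>Y\<^sup>3 = 0\<close>, only the coefficients up to degree \<open>2\<close> of the polynomial enter, and
  \<open>Y\<^sup>2\<close> has the single entry \<open>Y\<^sub>1\<^sub>2 Y\<^sub>2\<^sub>3\<close>.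
\<close>

lemma poly_mat_b_u:
  assumes "Y \<in> b_u" "coeff p 0 = 1"
  shows "poly_mat p Y = mat3 1 (coeff p 1 * Y$1$2) (coeff p 1 * Y$1$3 + coeff p 2 * (Y$1$2 * Y$2$3))
    0 1 (coeff p 1 * Y$2$3) 0 0 1"
proof -
  let ?pow = "\<lambda>i. (((**) Y) ^^ i) (mat 1)"
  have pow3: "?pow (3 + k) = 0" for k
  proof (induction k)
    case 0
    then show ?case using cube_strictly_upper[OF assms(1)] by (simp add: eval_nat_numeral)
  next
    case (Suc k)
    have "?pow (3 + Suc k) = Y ** ?pow (3 + k)"
      by (simp only: add_Suc_right funpow.simps comp_apply)
    then show ?case unfolding Suc by (simp add: vec_eq_iff mult_3)
  qed
  have "mat (coeff p i) ** ?pow i = 0" if "i \<notin> {..2}" for i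
  proof -
    have "i = 3 + (i - 3)" using that by auto
    then have "?pow i = 0" using pow3 by metis
    then show ?thesis by (simp add: vec_eq_iff mult_3 mat_def)
  qed
  moreover have "mat (coeff p i) ** ?pow i = 0" if "i \<notin> {..degree p}" for i
    using that by (simp add: vec_eq_iff mult_3 mat_def coeff_eq_0)
  ultimately have "poly_mat p Y = (\<Sum>i\<le>2. mat (coeff p i) ** ?pow i)"
    unfolding poly_mat_def by (intro sum.mono_neutral_cong) auto
  also have "\<dots> = mat3 1 (coeff p 1 * Y$1$2) (coeff p 1 * Y$1$3 + coeff p 2 * (Y$1$2 * Y$2$3))
    0 1 (coeff p 1 * Y$2$3) 0 0 1"
    using assms by (simp add: eval_nat_numeral vec_eq_iff forall_3 mult_3 mat3_def mat_def b_u_def)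
  finally show ?thesis .
qed

lemma unipotent_A_Iwahori_coset:
  assumes "0 \<le> fls_subdegree f"
  shows "mat3 1 0 f 0 1 0 0 0 1 <#\<^bsub>loop_grp\<^esub> Iwahori = Iwahori"
proof -
  have unipotent: "mat3 1 0 x 0 1 0 0 0 1 \<in> Iwahori" if "0 \<le> fls_subdegree x" for x
    by (rule mat3_Iwahori) (use that in \<open>simp_all add: det_3 mat3_def\<close>)
  have inverse: "mat3 1 0 f 0 1 0 0 0 1 ** (mat3 1 0 (- f) 0 1 0 0 0 1 ** M) = M" for M :: matF
    by (simp add: vec_eq_iff forall_3 mult_3 mat3_def)
  show ?thesis
    unfolding loop_coset
  proof (intro equalityI subsetI)
    fix M assume "M \<in> Iwahori"
    then have "mat3 1 0 (- f) 0 1 0 0 0 1 ** M \<in> Iwahori"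
      using Iwahori_mult unipotent[of "- f"] assms by simp
    then show "M \<in> (**) (mat3 1 0 f 0 1 0 0 0 1) ` Iwahori"
      using inverse[of M] by (metis image_eqI)
  qed (use Iwahori_mult unipotent[OF assms] in blast)
qed

text \<open>
  Otherwise \<open>0\<close> and \<open>E\<^sub>1\<^sub>3\<close> over the base point have the same image. They are different points of the
  cotangent bundle because conjugation keeps \<open>0\<close> fixed.
\<close>

lemma injective_imp_pole:
  assumes "coeff p 0 = 1" "inj_on (psi p) cotangent_bundle"
  shows "fls_subdegree (coeff p 1) < 0"
proof (rule ccontr)
  assume "\<not> fls_subdegree (coeff p 1) < 0"
  then have f: "0 \<le> fls_subdegree (coeff p 1)" by simp
  let ?E = "mat3 0 0 1 0 0 0 0 0 0"
  have E: "?E \<in> b_u" "0 \<in> b_u"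
    by (simp_all add: b_u_def forall_3 mat3_def K_ring_closed mat_def)
  have one: "mat 1 \<in> carrier G_grp" using one_in_torus torus_subset_carrier by blast
  have "poly_mat p (0) = mat 1"
    unfolding poly_mat_b_u[OF E(2) assms(1)] by (simp add: vec_eq_iff forall_3 mat3_def mat_def)
  moreover have "poly_mat p ?E = mat3 1 0 (coeff p 1) 0 1 0 0 0 1"
    unfolding poly_mat_b_u[OF E(1) assms(1)] by (simp add: mat3_def)
  ultimately have "psi p (cotangent_class (mat 1) (0)) = psi p (cotangent_class (mat 1) ?E)"
    unfolding psi_class[OF one E(1)] psi_class[OF one E(2)] 
    by (simp add: unipotent_A_Iwahori_coset[OF f] loop_coset[of "mat 1"] del: One_nat_def)
  moreover have "cotangent_class (mat 1) Y \<in> cotangent_bundle" if "Y \<in> b_u" for Y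
    unfolding cotangent_class_def cotangent_bundle_def using one that by (intro quotientI) simp
  ultimately have "cotangent_class (mat 1) (0) = cotangent_class (mat 1) ?E"
    using assms(2) E by (blast dest: inj_onD)
  moreover have "mat 1 \<in> Borel" 
    using one by (simp add: Borel_def mat_def)
  then have "(mat 1, ?E) \<in> cotangent_class (mat 1) ?E"
    using one E by (auto simp: cotangent_class_def cotangent_rel_def matrix_inv_eq[of "mat 1" "mat 1"] intro!: bexI[of _ "mat 1"])
  ultimately have "(mat 1, ?E) \<in> cotangent_class (mat 1) (0)" by simp
  then obtain b :: matF where "?E = matrix_inv b ** 0 ** b"
    by (auto simp: cotangent_class_def cotangent_rel_def)
  also have "\<dots> = 0" by (simp add: vec_eq_iff mult_3 mat_def)
  finally have "?E$1$3 = (0 :: matF)$1$3" by simp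
  then show False by (simp add: mat3_def mat_def)
qed

theorem proposition7p1:
  fixes p :: "complex fls poly"
  assumes "coeff p 0 = 1"
    and "inj_on (psi p) cotangent_bundle"
  shows "\<exists>g \<in> carrier G_grp. \<exists>w \<in> carrier affine_Weyl. \<exists>Y \<in> b_u.
           psi p (cotangent_class g Y) \<in> mod_Iwahori (Bruhat_cell w) \<and> Coxeter_length w > 6"
proof -
  define g where "g = mat3 0 0 1 0 (- 1) 0 1 0 0"
  define Y where "Y = mat3 0 1 0 0 0 1 0 0 0"
  have g: "g \<in> carrier G_grp"
    by (simp add: SL3_def g_def det_3 forall_3 mat3_def K_ring_closed)
  have Y: "Y \<in> b_u"
    by (simp add: b_u_def Y_def forall_3 mat3_def K_ring_closed)
  have "g ** poly_mat p Y = mat3 0 0 1 0 (- 1) (- coeff p 1) 1 (coeff p 1) (coeff p 2)"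
    unfolding poly_mat_b_u[OF Y assms(1)]
    by (simp add: vec_eq_iff forall_3 mult_3 mat3_def g_def Y_def)
  moreover obtain w where "w \<in> carrier affine_Weyl" "6 < Coxeter_length w"
      "mat3 0 0 1 0 (- 1) (- coeff p 1) 1 (coeff p 1) (coeff p 2) \<in> Bruhat_cell w"
    using long_Bruhat_cell[OF injective_imp_pole[OF assms]] by blast
  ultimately have "psi p (cotangent_class g Y) \<in> mod_Iwahori (Bruhat_cell w)"
    unfolding psi_class[OF g Y] mod_Iwahori_def by simp
  then show ?thesis
    using g Y \<open>w \<in> carrier affine_Weyl\<close> \<open>6 < Coxeter_length w\<close> by blast
qed

end
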